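(* Let $\phi\in(0,1)$, $\eta>0$, and consider the Primal ACI procedure run with step size $\eta$ on an arbitrary sequence of contexts $x_1,\dots,x_T\in\mathcal X$, with $Y_t=Y(x_t,\tau_t)$. For any integers $\ell<u$ with $[\ell,u]\subseteq[1,T]$, setting $L=u-\ell$, $$\left|\frac1L\sum_{t=\ell}^{u-1}Y_t-\phi\right|=\frac{|\tau_u-\tau_\ell|}{\eta L}.$$
   Context: Scalar-threshold setting. There is a context space $\mathcal X$, an interval $[\tau_{\min},\tau_{\max}]$, and a success indicator $Y(x,\tau)\in\{0,1\}$. For each $x\in\mathcal X$ there is $\tau_x\in(\tau_{\min},\tau_{\max})$ with $Y(x,\tau)=0$ for $\tau<\tau_x$ and $Y(x,\tau)=1$ for $\tau\ge\tau_x$. $Y(x,\cdot)$ is extended to all real $\tau$ by clipping $\tau$ to $[\tau_{\min},\tau_{\max}]$. Primal ACI procedure with step size $\eta>0$: at each step $t$ the policy uses threshold $\tau_t$, observes only $Y(x_t,\tau_t)$, and updates, without projection, $$\tau_{t+1}=\tau_t+\eta\left(\phi-Y(x_t,\tau_t)\right).$$ *)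

theory Defs
  imports Complex_Main
begin

definition threshold_success ::
  "'x set \<Rightarrow> real \<Rightarrow> real \<Rightarrow> ('x \<Rightarrow> real \<Rightarrow> real) \<Rightarrow> bool" where
  "threshold_success X \<tau>min \<tau>max Y \<longleftrightarrow>
     \<tau>min < \<tau>max \<and>
     (\<forall>x\<in>X. \<forall>\<tau>\<in>{\<tau>min..\<tau>max}. Y x \<tau> \<in> {0, 1}) \<and>
     (\<forall>x\<in>X. \<exists>\<tau>x. \<tau>min < \<tau>x \<and> \<tau>x < \<tau>max \<and>
        (\<forall>\<tau>\<in>{\<tau>min..\<tau>max}. (\<tau> < \<tau>x \<longrightarrow> Y x \<tau> = 0) \<and> (\<tau> \<ge> \<tau>x \<longrightarrow> Y x \<tau> = 1)))"

definition clip :: "real \<Rightarrow> real \<Rightarrow> real \<Rightarrow> real" where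
  "clip lo hi \<tau> = max lo (min hi \<tau>)"

text \<open>Only the values of \<open>Y x\<close> on the interval matter; elsewhere the clipped extension is used.\<close>

definition clipped_success ::
  "real \<Rightarrow> real \<Rightarrow> ('x \<Rightarrow> real \<Rightarrow> real) \<Rightarrow> 'x \<Rightarrow> real \<Rightarrow> real" where
  "clipped_success \<tau>min \<tau>max Y x \<tau> = Y x (clip \<tau>min \<tau>max \<tau>)"

text \<open>Steps are numbered from 1 to \<open>T\<close>. The initial threshold \<open>\<tau> 1\<close> is an arbitrary real;
  step \<open>T\<close> still performs its update, which produces \<open>\<tau> (T + 1)\<close>.\<close>

definition primal_aci_run ::
  "real \<Rightarrow> real \<Rightarrow> ('x \<Rightarrow> real \<Rightarrow> real) \<Rightarrow> real \<Rightarrow> real \<Rightarrow> nat \<Rightarrow>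
    (nat \<Rightarrow> 'x) \<Rightarrow> (nat \<Rightarrow> real) \<Rightarrow> bool" where
  "primal_aci_run \<tau>min \<tau>max Y \<phi> \<eta> T x \<tau> \<longleftrightarrow>
     (\<forall>t\<in>{1..T}. \<tau> (t + 1) = \<tau> t + \<eta> * (\<phi> - clipped_success \<tau>min \<tau>max Y (x t) (\<tau> t)))"

end

theory Submission
  imports Defs
begin

text \<open>Without projection, each update moves the threshold by exactly \<eta> times the signed
  error \<phi> - \<open>Yt t\<close>, so the threshold is a running ledger of the errors. Summing
  the increments over \<open>{l..<u}\<close> telescopes: the net displacement is \<eta> times the
  accumulated error, with no remainder. Dividing by \<open>\<eta> * L\<close> gives an exact
  identity, not just a bound.\<close>

theorem theorem3:
  fixes X :: "'x set" and \<tau>min \<tau>max \<phi> \<eta> L :: real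
    and Y :: "'x \<Rightarrow> real \<Rightarrow> real"
    and T l u :: nat
    and x :: "nat \<Rightarrow> 'x" and \<tau> Yt :: "nat \<Rightarrow> real"
  assumes "threshold_success X \<tau>min \<tau>max Y"
    and "0 < \<phi>" and "\<phi> < 1" and "0 < \<eta>"
    and "\<forall>t\<in>{1..T}. x t \<in> X"
    and "primal_aci_run \<tau>min \<tau>max Y \<phi> \<eta> T x \<tau>"
    and "\<forall>t\<in>{1..T}. Yt t = clipped_success \<tau>min \<tau>max Y (x t) (\<tau> t)"
    and "l < u" and "{l..u} \<subseteq> {1..T}"
    and "L = real u - real l"
  shows "\<bar>1 / L * (\<Sum>t = l..<u. Yt t) - \<phi>\<bar> = \<bar>\<tau> u - \<tau> l\<bar> / (\<eta> * L)"
proof -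
  have step: "\<tau> (Suc t) - \<tau> t = \<eta> * (\<phi> - Yt t)" if "t \<in> {l..<u}" for t
  proof -
    \<comment> \<open>The half-open range matches the run: \<tau> at \<open>u\<close> is produced by
      the update at step \<open>u - 1\<close>, so only steps \<open>l\<close> to
      \<open>u - 1\<close> are summed.\<close>
    have "t \<in> {1..T}"
      using that assms(9) by auto
    then show ?thesis
      using assms(6,7) by (simp add: primal_aci_run_def)
  qed
  have "\<tau> u - \<tau> l = (\<Sum>t = l..<u. \<tau> (Suc t) - \<tau> t)"
    using \<open>l < u\<close> by (simp add: sum_Suc_diff')
  also have "\<dots> = (\<Sum>t = l..<u. \<eta> * (\<phi> - Yt t))"
    by (rule sum.cong) (use step in auto)
  also have "\<dots> = \<eta> * (L * \<phi> - (\<Sum>t = l..<u. Yt t))"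
    using assms(8,10) by (simp add: sum_subtractf of_nat_diff flip: sum_distrib_left)
  finally have tele: "\<tau> u - \<tau> l = \<eta> * (L * \<phi> - (\<Sum>t = l..<u. Yt t))" .
  have "L > 0"
    using assms(8,10) by simp
  \<comment> \<open>The sign flips because excess successes push the threshold down; the absolute
    value removes it.\<close>
  then have "1 / L * (\<Sum>t = l..<u. Yt t) - \<phi> = - ((\<tau> u - \<tau> l) / (\<eta> * L))"
    using \<open>0 < \<eta>\<close> unfolding tele by (simp add: field_simps)
  then show ?thesis
    using \<open>L > 0\<close> \<open>0 < \<eta>\<close> by (simp add: abs_mult)
qed

end
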